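(* Let $E$ be a $\sigma$-orthocomplete atomic effect algebra with the Riesz Decomposition Property (RDP), and let $A(E)=\{a_i\mid i\in I\}$ be the set of all atoms of $E$ (indexed without repetition), which is assumed to be at most countable. Let $\imath_i$ be the isotropic index of $a_i\in A(E)$. Then the following statements hold. (i) For any $a_i\in A(E)$, the element $\imath_i a_i$ is a central element of $E$. (ii) For any $a_i\in A(E)$, the element $\imath_i a_i$ is an atom of the Boolean algebra $C(E)$. (iii) For any $y\in E$, $y=\sum\{y\wedge \imath_i a_i\mid a_i\in A(E)\}$. (iv) The effect algebra $E$ is isomorphic to the product effect algebra $\prod_{i\in I}E[0,\imath_i a_i]$. (v) The effect algebra $E$ is a $\sigma$-complete MV-effect algebra.
   Context: An effect algebra is a system $(E;+,0,1)$ with elements $0,1\in E$ and a partial binary operation $+$ such that for all $a,b,c\in E$: (E1) if $a+b$ is defined then $b+a$ is defined and $a+b=b+a$; (E2) if $a+b$ and $(a+b)+c$ are defined, then $b+c$ and $a+(b+c)$ are defined and $(a+b)+c=a+(b+c)$; (E3) for each $a$ there is a unique $b$, denoted $a'$, such that $a+b$ is defined and $a+b=1$; (E4) if $a+1$ is defined then $a=0$. The partial order is $a\leqslant b$ iff $c+a=b$ for some $c\in E$; then $0\leqslant a\leqslant 1$ for all $a$. Meets, joins, lattice properties refer to this order. RDP: whenever $a_1+a_2=b_1+b_2$ in $E$, there are $c_{11},c_{12},c_{21},c_{22}\in E$ with $a_i=c_{i1}+c_{i2}$ and $b_j=c_{1j}+c_{2j}$ for $i,j\in\{1,2\}$. An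 atom of a poset with least element $0$ is an element $a\neq 0$ such that the interval $\{x\mid 0\leqslant x\leqslant a\}$ equals $\{0,a\}$. $E$ is atomic if for every nonzero $x\in E$ there is an atom $a\leqslant x$. For an integer $n\ge 0$: $0a=0$, $1a=a$, $na=(n-1)a+a$ if defined. The isotropic index of $a$ is the maximal $n\ge 0$ such that $na$ exists in $E$ ($+\infty$ if $na$ exists for all $n$). (In the setting of the claim isotropic indices of atoms are finite, so $\imath_i a_i$ makes sense.) A finite sequence $(a_1,\dots,a_n)$ is orthogonal if $a_1+\cdots+a_n$ exists in $E$. A system $A=(a_i)_{i\in I}$ of (not necessarily different) elements is orthogonal if every finite subsystem is orthogonal; its sum $\sum A$ is $\bigvee\{\sum F\mid F \text{ a finite subsystem of } A\}$, if this supremum exists. $E$ is $\sigma$-orthocomplete if every countable orthogonal system has a sum. An element $e\in E$ is principal if $x,y\leqslant e$ and $x+y$ defined imply $x+y\leqslant e$. An element $e$ is central if $e$ and $e'$ are principal and every $p\in E$ can be written as $p=q+r$ with $q\leqslant e$, $r\leqslant e'$. $C(E)$ is the set of central elements; with the order of $E$ it is a Boolean algebra. (If $E$ has RDP, $e$ is central iff $e\wedge e'=0$.) For $a\in E$, $E[0,a]=\{x\in E\mid 0\leqslant x\leqslant a\}$ is an effect algebra with unit $a$, where $x+y$ is defined in $E[0,a]$ iff it is defined in $E$ and $x+y\leqslant a$. Products of effect algebras carry coordinatewise operations (a sum is defined iff it is defined in each coordinate). An isomorphism of effect algebras is a bijection $\phi$ with $\phi(1)=1$ such that $x+y$ is defined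 iff $\phi(x)+\phi(y)$ is defined, and then $\phi(x+y)=\phi(x)+\phi(y)$. Two elements $a,b\in E$ are compatible if there are $a_1,b_1,c\in E$ with $a=a_1+c$, $b=b_1+c$ and $a_1+b_1+c$ defined in $E$. An MV-effect algebra is a lattice-ordered effect algebra in which all elements are mutually compatible; it is $\sigma$-complete if every countable subset has a supremum and an infimum. *)

theory Defs
  imports
    "HOL-Algebra.Lattice"
    "HOL-Library.Extended_Nat"
    "HOL-Library.Countable_Set"
    "HOL-Library.FuncSet"
begin

section \<open>Effect algebras\<close>

text \<open>
  The partial sum is option-valued: \<open>x \<^bold>+\<^bsub>E\<^esub> y = None\<close> means that the sum is undefined.
  Its values are meaningful only for arguments from the carrier.
\<close>

record 'a effect_alg = "'a partial_object" +
  padd :: "'a \<Rightarrow> 'a \<Rightarrow> 'a option"  (infixl \<open>\<^bold>+\<index>\<close> 65)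
  ezero :: 'a  (\<open>\<^bold>0\<index>\<close>)
  eone :: 'a  (\<open>\<^bold>1\<index>\<close>)

locale effect_algebra =
  fixes E :: "('a, 'b) effect_alg_scheme" (structure)
  assumes zero_closed: "\<^bold>0 \<in> carrier E"
    and one_closed: "\<^bold>1 \<in> carrier E"
    and padd_closed: "\<lbrakk>a \<in> carrier E; b \<in> carrier E; a \<^bold>+ b = Some c\<rbrakk> \<Longrightarrow> c \<in> carrier E"
    and E1: "\<lbrakk>a \<in> carrier E; b \<in> carrier E; a \<^bold>+ b = Some c\<rbrakk> \<Longrightarrow> b \<^bold>+ a = Some c"
    and E2: "\<lbrakk>a \<in> carrier E; b \<in> carrier E; c \<in> carrier E; a \<^bold>+ b = Some d; d \<^bold>+ c = Some e\<rbrakk>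
               \<Longrightarrow> \<exists>f. b \<^bold>+ c = Some f \<and> a \<^bold>+ f = Some e"
    and E3: "a \<in> carrier E \<Longrightarrow> \<exists>!b. b \<in> carrier E \<and> a \<^bold>+ b = Some \<^bold>1"
    and E4: "\<lbrakk>a \<in> carrier E; a \<^bold>+ \<^bold>1 \<noteq> None\<rbrakk> \<Longrightarrow> a = \<^bold>0"

definition osupp :: "('a, 'b) effect_alg_scheme \<Rightarrow> 'a \<Rightarrow> 'a" where
  "osupp E a = (THE b. b \<in> carrier E \<and> a \<^bold>+\<^bsub>E\<^esub> b = Some \<^bold>1\<^bsub>E\<^esub>)"

definition ea_le :: "('a, 'b) effect_alg_scheme \<Rightarrow> 'a \<Rightarrow> 'a \<Rightarrow> bool" where
  "ea_le E a b \<longleftrightarrow> (\<exists>c\<in>carrier E. c \<^bold>+\<^bsub>E\<^esub> a = Some b)"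

definition ea_poset :: "('a, 'b) effect_alg_scheme \<Rightarrow> 'a gorder" where
  "ea_poset E = \<lparr>carrier = carrier E, eq = (=), le = ea_le E\<rparr>"

definition rdp :: "('a, 'b) effect_alg_scheme \<Rightarrow> bool" where
  "rdp E \<longleftrightarrow>
     (\<forall>a1\<in>carrier E. \<forall>a2\<in>carrier E. \<forall>b1\<in>carrier E. \<forall>b2\<in>carrier E.
        a1 \<^bold>+\<^bsub>E\<^esub> a2 \<noteq> None \<longrightarrow> a1 \<^bold>+\<^bsub>E\<^esub> a2 = b1 \<^bold>+\<^bsub>E\<^esub> b2 \<longrightarrow>
        (\<exists>c11\<in>carrier E. \<exists>c12\<in>carrier E. \<exists>c21\<in>carrier E. \<exists>c22\<in>carrier E.
           c11 \<^bold>+\<^bsub>E\<^esub> c12 = Some a1 \<and> c21 \<^bold>+\<^bsub>E\<^esub> c22 = Some a2 \<and>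
           c11 \<^bold>+\<^bsub>E\<^esub> c21 = Some b1 \<and> c12 \<^bold>+\<^bsub>E\<^esub> c22 = Some b2))"


section \<open>Atoms and isotropic indices\<close>

definition atoms_of :: "('a, 'b) gorder_scheme \<Rightarrow> 'a set" where
  "atoms_of L = {a \<in> carrier L. a \<noteq> \<bottom>\<^bsub>L\<^esub> \<and>
                   {x \<in> carrier L. \<bottom>\<^bsub>L\<^esub> \<sqsubseteq>\<^bsub>L\<^esub> x \<and> x \<sqsubseteq>\<^bsub>L\<^esub> a} = {\<bottom>\<^bsub>L\<^esub>, a}}"

definition ea_atoms :: "('a, 'b) effect_alg_scheme \<Rightarrow> 'a set" where
  "ea_atoms E = atoms_of (ea_poset E)"

definition atomic :: "('a, 'b) effect_alg_scheme \<Rightarrow> bool" where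
  "atomic E \<longleftrightarrow> (\<forall>x\<in>carrier E. x \<noteq> \<^bold>0\<^bsub>E\<^esub> \<longrightarrow> (\<exists>a\<in>ea_atoms E. ea_le E a x))"

primrec nmult :: "('a, 'b) effect_alg_scheme \<Rightarrow> nat \<Rightarrow> 'a \<Rightarrow> 'a option" where
  "nmult E 0 a = Some \<^bold>0\<^bsub>E\<^esub>"
| "nmult E (Suc n) a = Option.bind (nmult E n a) (\<lambda>x. x \<^bold>+\<^bsub>E\<^esub> a)"

definition isotropic_index :: "('a, 'b) effect_alg_scheme \<Rightarrow> 'a \<Rightarrow> enat" where
  "isotropic_index E a = Sup (enat ` {n. nmult E n a \<noteq> None})"

text \<open>
  The element \<open>\<iota> a\<close>, where \<open>\<iota>\<close> is the isotropic index of \<open>a\<close>; it is meaningful only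
  if \<open>\<iota>\<close> is finite.
\<close>

definition isotropic_mult :: "('a, 'b) effect_alg_scheme \<Rightarrow> 'a \<Rightarrow> 'a" where
  "isotropic_mult E a = the (nmult E (the_enat (isotropic_index E a)) a)"


section \<open>Orthogonal systems and their sums\<close>

definition seq_sum :: "('a, 'b) effect_alg_scheme \<Rightarrow> 'a list \<Rightarrow> 'a option" where
  "seq_sum E xs = foldl (\<lambda>s x. Option.bind s (\<lambda>s'. s' \<^bold>+\<^bsub>E\<^esub> x)) (Some \<^bold>0\<^bsub>E\<^esub>) xs"

text \<open>
  A finite subsystem of \<open>(f i)\<^sub>i\<^sub>\<in>\<^sub>J\<close> is given by enumerating its index set by a list without
  repetitions; the order of the enumeration does not affect the sum.
\<close>

definition orthogonal_system :: "('a, 'b) effect_alg_scheme \<Rightarrow> 'i set \<Rightarrow> ('i \<Rightarrow> 'a) \<Rightarrow> bool" where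
  "orthogonal_system E J f \<longleftrightarrow>
     f ` J \<subseteq> carrier E \<and>
     (\<forall>is. distinct is \<and> set is \<subseteq> J \<longrightarrow> seq_sum E (map f is) \<noteq> None)"

definition finite_sums :: "('a, 'b) effect_alg_scheme \<Rightarrow> 'i set \<Rightarrow> ('i \<Rightarrow> 'a) \<Rightarrow> 'a set" where
  "finite_sums E J f = {s. \<exists>is. distinct is \<and> set is \<subseteq> J \<and> seq_sum E (map f is) = Some s}"

definition is_sum :: "('a, 'b) effect_alg_scheme \<Rightarrow> 'i set \<Rightarrow> ('i \<Rightarrow> 'a) \<Rightarrow> 'a \<Rightarrow> bool" where
  "is_sum E J f s \<longleftrightarrow>
     orthogonal_system E J f \<and>
     is_lub (ea_poset E) s (finite_sums E J f)"

text \<open>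
  Every countable system can be reindexed by a set of natural numbers, so it suffices to
  quantify over index sets \<open>J :: nat set\<close> (a definition cannot quantify over index types).
\<close>

definition sigma_orthocomplete :: "('a, 'b) effect_alg_scheme \<Rightarrow> bool" where
  "sigma_orthocomplete E \<longleftrightarrow>
     (\<forall>(J :: nat set) f. orthogonal_system E J f \<longrightarrow> (\<exists>s. is_sum E J f s))"


section \<open>Central elements\<close>

definition principal :: "('a, 'b) effect_alg_scheme \<Rightarrow> 'a \<Rightarrow> bool" where
  "principal E e \<longleftrightarrow> e \<in> carrier E \<and>
     (\<forall>x\<in>carrier E. \<forall>y\<in>carrier E. \<forall>z.
        ea_le E x e \<and> ea_le E y e \<and> x \<^bold>+\<^bsub>E\<^esub> y = Some z \<longrightarrow> ea_le E z e)"

definition central_elements :: "('a, 'b) effect_alg_scheme \<Rightarrow> 'a set" where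
  "central_elements E = {e \<in> carrier E. principal E e \<and> principal E (osupp E e) \<and>
     (\<forall>p\<in>carrier E. \<exists>q\<in>carrier E. \<exists>r\<in>carrier E.
        ea_le E q e \<and> ea_le E r (osupp E e) \<and> q \<^bold>+\<^bsub>E\<^esub> r = Some p)}"

definition center_poset :: "('a, 'b) effect_alg_scheme \<Rightarrow> 'a gorder" where
  "center_poset E = \<lparr>carrier = central_elements E, eq = (=), le = ea_le E\<rparr>"


section \<open>Intervals, products and isomorphisms\<close>

definition ea_interval :: "('a, 'b) effect_alg_scheme \<Rightarrow> 'a \<Rightarrow> 'a effect_alg" where
  "ea_interval E a =
     \<lparr>carrier = {x \<in> carrier E. ea_le E \<^bold>0\<^bsub>E\<^esub> x \<and> ea_le E x a},
      padd = (\<lambda>x y. case x \<^bold>+\<^bsub>E\<^esub> y of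
                      None \<Rightarrow> None
                    | Some z \<Rightarrow> if ea_le E z a then Some z else None),
      ezero = \<^bold>0\<^bsub>E\<^esub>,
      eone = a\<rparr>"

definition ea_product ::
    "'i set \<Rightarrow> ('i \<Rightarrow> ('a, 'b) effect_alg_scheme) \<Rightarrow> ('i \<Rightarrow> 'a) effect_alg" where
  "ea_product I F =
     \<lparr>carrier = (\<Pi>\<^sub>E i\<in>I. carrier (F i)),
      padd = (\<lambda>f g. if \<forall>i\<in>I. f i \<^bold>+\<^bsub>F i\<^esub> g i \<noteq> None
                    then Some (\<lambda>i\<in>I. the (f i \<^bold>+\<^bsub>F i\<^esub> g i)) else None),
      ezero = (\<lambda>i\<in>I. \<^bold>0\<^bsub>F i\<^esub>),
      eone = (\<lambda>i\<in>I. \<^bold>1\<^bsub>F i\<^esub>)\<rparr>"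

definition ea_iso ::
    "('a, 'b) effect_alg_scheme \<Rightarrow> ('c, 'd) effect_alg_scheme \<Rightarrow> ('a \<Rightarrow> 'c) set" where
  "ea_iso E F = {\<phi>. bij_betw \<phi> (carrier E) (carrier F) \<and> \<phi> \<^bold>1\<^bsub>E\<^esub> = \<^bold>1\<^bsub>F\<^esub> \<and>
     (\<forall>x\<in>carrier E. \<forall>y\<in>carrier E.
        (x \<^bold>+\<^bsub>E\<^esub> y \<noteq> None \<longleftrightarrow> \<phi> x \<^bold>+\<^bsub>F\<^esub> \<phi> y \<noteq> None) \<and>
        (\<forall>z. x \<^bold>+\<^bsub>E\<^esub> y = Some z \<longrightarrow> \<phi> x \<^bold>+\<^bsub>F\<^esub> \<phi> y = Some (\<phi> z)))}"

definition ea_isomorphic ::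
    "('a, 'b) effect_alg_scheme \<Rightarrow> ('c, 'd) effect_alg_scheme \<Rightarrow> bool" where
  "ea_isomorphic E F \<longleftrightarrow> ea_iso E F \<noteq> {}"


section \<open>MV-effect algebras\<close>

definition compatible :: "('a, 'b) effect_alg_scheme \<Rightarrow> 'a \<Rightarrow> 'a \<Rightarrow> bool" where
  "compatible E a b \<longleftrightarrow>
     (\<exists>a1\<in>carrier E. \<exists>b1\<in>carrier E. \<exists>c\<in>carrier E.
        a1 \<^bold>+\<^bsub>E\<^esub> c = Some a \<and> b1 \<^bold>+\<^bsub>E\<^esub> c = Some b \<and>
        Option.bind (a1 \<^bold>+\<^bsub>E\<^esub> b1) (\<lambda>s. s \<^bold>+\<^bsub>E\<^esub> c) \<noteq> None)"

locale mv_effect_algebra = effect_algebra +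
  assumes lattice_ordered: "lattice (ea_poset E)"
    and all_compatible: "\<lbrakk>a \<in> carrier E; b \<in> carrier E\<rbrakk> \<Longrightarrow> compatible E a b"

locale sigma_complete_mv_effect_algebra = mv_effect_algebra +
  assumes countable_sup:
      "\<lbrakk>S \<subseteq> carrier E; countable S\<rbrakk> \<Longrightarrow> \<exists>s. is_lub (ea_poset E) s S"
    and countable_inf:
      "\<lbrakk>S \<subseteq> carrier E; countable S\<rbrakk> \<Longrightarrow> \<exists>s. is_glb (ea_poset E) s S"

end

theory Submission
  imports Defs
begin

text \<open>
  Write \<open>m\<^sub>c\<close> for the largest multiple of an atom \<open>c\<close>. It exists: if all multiples of a nonzero
  \<open>c\<close> were defined, their supremum \<open>s\<close> would satisfy \<open>s \<le> s - c\<close>. The proof shows that an element is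
  determined by its parts below the \<open>m\<^sub>c\<close>, and that these parts can be prescribed freely.

  The Riesz Decomposition Property enters through disjointness, that is, having no common nonzero
  lower bound. Disjoint elements below \<open>z\<close> have a sum below \<open>z\<close> (\<open>disjoint_psum\<close>), so for disjoint
  elements sums are joins. If \<open>e\<close> and \<open>e'\<close> are disjoint, every \<open>x\<close> splits as \<open>x = q + r\<close> with
  \<open>q \<le> e\<close> and \<open>r \<le> e'\<close>; here \<open>q = x \<and> e\<close>, the map \<open>x \<mapsto> x \<and> e\<close> is additive, and \<open>e\<close> is central.
  This applies to \<open>m\<^sub>c\<close>: by Riesz decomposition everything below it is a multiple of \<open>c\<close>, and a
  nonzero multiple of \<open>c\<close> below the orthosupplement would make \<open>m\<^sub>c + c\<close> defined. A central element
  containing \<open>c\<close> is principal, hence contains all multiples of \<open>c\<close>, so \<open>m\<^sub>c\<close> is an atom of the center.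

  Blocks \<open>m\<^sub>c\<close> of different atoms are disjoint, so a family with one member below each block is
  orthogonal and its sum is the join of its members (\<open>is_sum_blocks_iff\<close>). For the parts \<open>y \<and> m\<^sub>c\<close> of
  an element \<open>y\<close>, an atom \<open>c\<close> in the difference between \<open>y\<close> and their sum could be added to
  \<open>y \<and> m\<^sub>c\<close> without leaving \<open>y\<close> or \<open>m\<^sub>c\<close>; hence the sum is \<open>y\<close> (\<open>is_sum_coords\<close>). In the other
  direction, the part below \<open>m\<^sub>c\<close> of the sum \<open>s\<close> of a family is no larger than the member that was
  put there (\<open>coord_sum\<close>): otherwise \<open>c\<close> could be subtracted from \<open>s\<close> while leaving an upper bound
  of the family.

  Thus \<open>y \<mapsto> (y \<and> m\<^sub>c)\<^sub>c\<close> is an isomorphism onto the product of the intervals \<open>[0, m\<^sub>c]\<close>. Each of them is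
  a finite chain, so suprema and infima of arbitrary sets exist coordinatewise. Compatibility
  follows: after subtracting \<open>x \<and> y\<close> from \<open>x\<close> and from \<open>y\<close> the remainders are disjoint, hence have a
  sum below the orthosupplement of \<open>x \<and> y\<close>.
\<close>

section \<open>Sums and order in an effect algebra\<close>

context effect_algebra
begin

text \<open>
  The partial sum as a relation. Membership in the carrier is part of it, so that equations between
  sums can be chained without side conditions; the order \<open>\<preceq>\<close> inherits this property.
\<close>

definition psum :: "'a \<Rightarrow> 'a \<Rightarrow> 'a \<Rightarrow> bool" where
  "psum x y z \<longleftrightarrow> x \<in> carrier E \<and> y \<in> carrier E \<and> x \<^bold>+ y = Some z"

definition le :: "'a \<Rightarrow> 'a \<Rightarrow> bool"  (infix \<open>\<preceq>\<close> 50) where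
  "x \<preceq> y \<longleftrightarrow> (\<exists>c. psum x c y)"

definition disjoint :: "'a \<Rightarrow> 'a \<Rightarrow> bool" where
  "disjoint x y \<longleftrightarrow> (\<forall>z. z \<preceq> x \<longrightarrow> z \<preceq> y \<longrightarrow> z = \<^bold>0)"

lemma psum_closed:
  assumes "psum x y z"
  shows "x \<in> carrier E" "y \<in> carrier E" "z \<in> carrier E"
  using assms padd_closed unfolding psum_def by blast+

lemma psum_unique: "psum x y z \<Longrightarrow> psum x y z' \<Longrightarrow> z = z'"
  by (simp add: psum_def)

lemma psum_commute: "psum x y z \<Longrightarrow> psum y x z"
  using E1 by (auto simp: psum_def)

lemma psum_assoc: "psum x y s \<Longrightarrow> psum s z t \<Longrightarrow> \<exists>u. psum y z u \<and> psum x u t"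
  unfolding psum_def using E2 padd_closed by blast

lemma psum_assoc': "psum y z u \<Longrightarrow> psum x u t \<Longrightarrow> \<exists>s. psum x y s \<and> psum s z t"
  by (meson psum_assoc psum_commute)

lemma osupp_psum: 
  assumes "x \<in> carrier E" shows "psum x (osupp E x) \<^bold>1"
  using theI'[OF E3[OF assms]] assms unfolding osupp_def psum_def by blast

lemma osupp_closed: "x \<in> carrier E \<Longrightarrow> osupp E x \<in> carrier E"
  using osupp_psum psum_closed by blast

lemma osupp_unique: "psum x y \<^bold>1 \<Longrightarrow> y = osupp E x"
  using E3 osupp_psum[of x] unfolding psum_def by blast

lemma osupp_osupp: "x \<in> carrier E \<Longrightarrow> osupp E (osupp E x) = x"
  by (metis osupp_psum osupp_unique psum_commute)

lemma psum_one_imp_zero: "psum x \<^bold>1 z \<Longrightarrow> x = \<^bold>0"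
  using E4 by (auto simp: psum_def)

lemma psum_zero:
  assumes "x \<in> carrier E" shows "psum x \<^bold>0 x"
proof -
  have "psum \<^bold>1 \<^bold>0 \<^bold>1"
    by (metis one_closed osupp_psum psum_commute psum_one_imp_zero)
  then have "psum (osupp E y) \<^bold>0 (osupp E y)" if "y \<in> carrier E" for y
    by (metis that osupp_psum osupp_unique psum_assoc)
  then show ?thesis
    by (metis assms osupp_closed osupp_osupp)
qed

lemma psum_cancel: 
  assumes "psum x y z" "psum x y' z" shows "y = y'"
proof -
  \<comment> \<open>Complete both sums to \<open>1\<close> by the same element; both \<open>y\<close> and \<open>y'\<close> then turn out to be the
    orthosupplement of the same element \<open>v\<close>.\<close>
  have one: "psum z (osupp E z) \<^bold>1"
    using assms osupp_psum psum_closed by blast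
  obtain u where u: "psum y (osupp E z) u" "psum x u \<^bold>1"
    using psum_assoc[OF assms(1) one] by blast
  obtain u' where u': "psum y' (osupp E z) u'" "psum x u' \<^bold>1"
    using psum_assoc[OF assms(2) one] by blast
  have eq: "u' = u"
    using osupp_unique[OF u(2)] osupp_unique[OF u'(2)] by simp
  obtain v where v: "psum (osupp E z) x v" "psum y v \<^bold>1"
    using psum_assoc[OF u(1) psum_commute[OF u(2)]] by blast
  obtain v' where v': "psum (osupp E z) x v'" "psum y' v' \<^bold>1"
    using psum_assoc[OF u'(1)[unfolded eq] psum_commute[OF u(2)]] by blast
  have "v' = v"
    using v(1) v'(1) psum_unique by blast
  then show ?thesis
    using osupp_unique[OF psum_commute[OF v(2)]] osupp_unique[OF psum_commute[OF v'(2)]] by simp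
qed

lemma psum_eq_zero:
  assumes "psum x y \<^bold>0" shows "y = \<^bold>0"
  by (meson assms one_closed psum_assoc psum_commute psum_one_imp_zero psum_zero)

lemma le_closed: "x \<preceq> y \<Longrightarrow> x \<in> carrier E" "x \<preceq> y \<Longrightarrow> y \<in> carrier E"
  using psum_closed unfolding le_def by blast+

lemma ea_le_iff: "x \<in> carrier E \<Longrightarrow> ea_le E x y \<longleftrightarrow> x \<preceq> y"
  unfolding ea_le_def le_def using psum_commute psum_def by blast

lemma le_refl: "x \<in> carrier E \<Longrightarrow> x \<preceq> x"
  using psum_zero le_def by blast

lemma le_trans: "x \<preceq> y \<Longrightarrow> y \<preceq> z \<Longrightarrow> x \<preceq> z"
  unfolding le_def using psum_assoc by blast

lemma le_antisym: 
  assumes "x \<preceq> y" "y \<preceq> x" shows "x = y"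
proof -
  obtain c d where c: "psum x c y" and d: "psum y d x"
    using assms le_def by blast
  then obtain f where "psum c d f" "psum x f x"
    using psum_assoc by blast
  moreover have "f = \<^bold>0"
    using \<open>psum x f x\<close> psum_cancel psum_zero psum_closed by blast
  ultimately have "c = \<^bold>0"
    using psum_eq_zero psum_commute by blast
  then show ?thesis
    using c psum_zero psum_closed psum_unique by blast
qed

lemma zero_le: "x \<in> carrier E \<Longrightarrow> \<^bold>0 \<preceq> x"
  unfolding le_def using psum_zero psum_commute by blast

lemma le_one: "x \<in> carrier E \<Longrightarrow> x \<preceq> \<^bold>1"
  unfolding le_def using osupp_psum by blast

lemma le_zero: "x \<preceq> \<^bold>0 \<Longrightarrow> x = \<^bold>0"
  using le_antisym le_closed zero_le by blast

lemma psum_le: "psum x y z \<Longrightarrow> x \<preceq> z" "psum x y z \<Longrightarrow> y \<preceq> z"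
  unfolding le_def using psum_commute by blast+

text \<open>
  The contradiction used throughout: adding a nonzero element strictly increases.
\<close>

lemma psum_le_imp_zero: "psum x y z \<Longrightarrow> z \<preceq> x \<Longrightarrow> y = \<^bold>0"
  by (metis le_antisym psum_cancel psum_closed(1) psum_le(1) psum_zero)

lemma psum_le_mono:
  assumes "psum x y z" "y' \<preceq> y"
  shows "\<exists>z'. psum x y' z' \<and> z' \<preceq> z"
  using assms unfolding le_def using psum_assoc' by blast

lemma psum_le_cancel: 
  assumes "psum x y z" "psum x u w" "z \<preceq> w" shows "y \<preceq> u"
  using assms unfolding le_def by (metis psum_assoc psum_cancel)

lemma psum_interchange:
  assumes "psum q1 r1 x" "psum q2 r2 y" "psum x y z"
  shows "\<exists>q r. psum q1 q2 q \<and> psum r1 r2 r \<and> psum q r z"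
proof -
  obtain u where u: "psum r1 y u" "psum q1 u z"
    using assms psum_assoc by blast
  obtain v where v: "psum q2 r1 v" "psum v r2 u"
    using u(1) assms(2) psum_assoc' psum_commute by blast
  obtain r where r: "psum r1 r2 r" "psum q2 r u"
    using v psum_assoc by blast
  then show ?thesis
    using u(2) psum_assoc' by blast
qed

lemma le_osupp_iff: 
  assumes "x \<in> carrier E"
  shows "y \<preceq> osupp E x \<longleftrightarrow> (\<exists>z. psum x y z)"
proof
  assume "y \<preceq> osupp E x"
  then show "\<exists>z. psum x y z"
    using psum_le_mono osupp_psum assms by blast
next
  assume "\<exists>z. psum x y z"
  then obtain z where z: "psum x y z" by blast
  then show "y \<preceq> osupp E x"
    using psum_le_cancel[OF z osupp_psum] le_one psum_closed assms by blast
qed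

lemma disjoint_commute: "disjoint x y \<Longrightarrow> disjoint y x"
  by (auto simp: disjoint_def)

lemma disjoint_mono: "disjoint x y \<Longrightarrow> x' \<preceq> x \<Longrightarrow> y' \<preceq> y \<Longrightarrow> disjoint x' y'"
  unfolding disjoint_def using le_trans by blast

lemma partial_order_ea_poset: "partial_order (ea_poset E)"
  by unfold_locales
    (auto simp: ea_poset_def ea_le_iff intro: le_refl le_antisym le_trans)

lemma is_lub_iff: 
  assumes "S \<subseteq> carrier E"
  shows "is_lub (ea_poset E) s S \<longleftrightarrow>
    s \<in> carrier E \<and> (\<forall>x\<in>S. x \<preceq> s) \<and> (\<forall>u. (\<forall>x\<in>S. x \<preceq> u) \<longrightarrow> u \<in> carrier E \<longrightarrow> s \<preceq> u)"
  using assms by (auto simp: least_def Upper_def ea_poset_def ea_le_iff subset_iff)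

lemma is_glb_iff:
  assumes "S \<subseteq> carrier E"
  shows "is_glb (ea_poset E) s S \<longleftrightarrow>
    s \<in> carrier E \<and> (\<forall>x\<in>S. s \<preceq> x) \<and> (\<forall>u. (\<forall>x\<in>S. u \<preceq> x) \<longrightarrow> u \<in> carrier E \<longrightarrow> u \<preceq> s)"
  using assms by (auto simp: greatest_def Lower_def ea_poset_def ea_le_iff subset_iff)

lemma meet_eqI:
  assumes "is_glb (ea_poset E) g {x, y}"
  shows "x \<sqinter>\<^bsub>ea_poset E\<^esub> y = g"
  unfolding meet_def inf_def
  using assms by (rule some_equality) 
    (rule partial_order.greatest_unique[OF partial_order_ea_poset _ assms])

text \<open>
  Stated for an arbitrary subposet because it is needed for the center as well as for the whole
  algebra.
\<close>

lemma bottom_eq_zero: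
  assumes "least L \<^bold>0 (carrier L)" "carrier L \<subseteq> carrier E" "Order.le L = ea_le E"
  shows "\<bottom>\<^bsub>L\<^esub> = \<^bold>0"
  unfolding bottom_def
proof (rule some_equality)
  show "least L \<^bold>0 (carrier L)" by (rule assms(1))
  fix x assume "least L x (carrier L)"
  then show "x = \<^bold>0"
    using assms unfolding least_def by (metis ea_le_iff le_zero subsetD)
qed

lemma ea_atoms_iff:
  "c \<in> ea_atoms E \<longleftrightarrow> c \<in> carrier E \<and> c \<noteq> \<^bold>0 \<and> (\<forall>x. x \<preceq> c \<longrightarrow> x = \<^bold>0 \<or> x = c)"
proof -
  have "\<bottom>\<^bsub>ea_poset E\<^esub> = \<^bold>0"
    by (rule bottom_eq_zero) (auto simp: least_def ea_poset_def zero_closed ea_le_iff zero_le)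
  then show ?thesis
    using le_refl le_closed zero_le
    by (auto simp: ea_atoms_def atoms_of_def ea_poset_def ea_le_iff zero_closed)
qed

lemma atom_closed: "c \<in> ea_atoms E \<Longrightarrow> c \<in> carrier E"
  by (simp add: ea_atoms_iff)

lemma nmult_closed: "c \<in> carrier E \<Longrightarrow> nmult E n c = Some x \<Longrightarrow> x \<in> carrier E"
  by (induction n arbitrary: x) (auto simp: zero_closed bind_eq_Some_conv intro: padd_closed)

lemma nmult_Suc_iff:
  assumes "c \<in> carrier E"
  shows "nmult E (Suc n) c = Some x \<longleftrightarrow> (\<exists>y. nmult E n c = Some y \<and> psum y c x)"
  using assms nmult_closed by (auto simp: bind_eq_Some_conv psum_def)

lemma nmult_mono:
  assumes "c \<in> carrier E" "nmult E n c = Some x" "k \<le> n"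
  shows "\<exists>y. nmult E k c = Some y \<and> y \<preceq> x"
  using assms(3,2)
proof (induction n arbitrary: x rule: dec_induct)
  case base
  then show ?case using assms(1) nmult_closed le_refl by blast
next
  case (step n)
  then show ?case 
    using nmult_Suc_iff[OF assms(1)] psum_le le_trans by metis
qed

lemma seq_sum_snoc: "seq_sum E (xs @ [x]) = Option.bind (seq_sum E xs) (\<lambda>s. s \<^bold>+ x)"
  by (simp add: seq_sum_def)

lemma seq_sum_const: "seq_sum E (map (\<lambda>_. c) js) = nmult E (length js) c"
  by (induction js rule: rev_induct) (simp_all add: seq_sum_snoc, simp add: seq_sum_def)

end

lemma finite_sums_reindex:
  assumes "inj_on h J"
  shows "finite_sums E (h ` J) f = finite_sums E J (f \<circ> h)"
proof -
  have "\<exists>js. distinct js \<and> set js \<subseteq> J \<and> is = map h js" if "distinct is" "set is \<subseteq> h ` J" for "is"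
  proof (intro exI conjI)
    show "distinct (map (inv_into J h) is)"
      using that by (simp add: distinct_map inj_on_inv_into)
    show "set (map (inv_into J h) is) \<subseteq> J"
      using that(2) by (auto dest: subsetD intro: inv_into_into)
    show "is = map h (map (inv_into J h) is)"
      using that by (auto intro!: map_idI[symmetric] simp: f_inv_into_f subsetD)
  qed
  then have "finite_sums E (h ` J) f \<subseteq> finite_sums E J (f \<circ> h)"
    unfolding finite_sums_def by fastforce
  moreover have "s \<in> finite_sums E (h ` J) f" if s: "s \<in> finite_sums E J (f \<circ> h)" for s
  proof -
    obtain js where js: "distinct js" "set js \<subseteq> J" "seq_sum E (map (f \<circ> h) js) = Some s"
      using s unfolding finite_sums_def by blast
    then have "distinct (map h js)" "set (map h js) \<subseteq> h ` J"
      using assms by (auto simp: distinct_map intro: inj_on_subset)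
    moreover have "seq_sum E (map f (map h js)) = Some s"
      using js(3) by simp
    ultimately show ?thesis
      unfolding finite_sums_def by blast
  qed
  ultimately show ?thesis by blast
qed

lemma orthogonal_system_comp:
  assumes "inj_on h J" "orthogonal_system E (h ` J) f"
  shows "orthogonal_system E J (f \<circ> h)"
  unfolding orthogonal_system_def
proof (intro conjI allI impI)
  show "(f \<circ> h) ` J \<subseteq> carrier E"
    using assms(2) by (auto simp: orthogonal_system_def)
  fix js assume "distinct js \<and> set js \<subseteq> J"
  then have "distinct (map h js) \<and> set (map h js) \<subseteq> h ` J"
    using assms(1) by (auto simp: distinct_map intro: inj_on_subset)
  then show "seq_sum E (map (f \<circ> h) js) \<noteq> None"
    using assms(2) unfolding orthogonal_system_def by (metis map_map)
qed

text \<open>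
  \<^const>\<open>sigma_orthocomplete\<close> speaks of systems indexed by natural numbers only; reindexing along
  an injection extends it to every countable index set.
\<close>

lemma sigma_orthocomplete_countable:
  assumes "sigma_orthocomplete E" "countable J" "orthogonal_system E J f"
  shows "\<exists>s. is_sum E J f s"
proof -
  obtain g :: "_ \<Rightarrow> nat" where g: "inj_on g J"
    using assms(2) countable_def by blast
  define h where "h = the_inv_into J g"
  have h: "inj_on h (g ` J)" "h ` (g ` J) = J"
    unfolding h_def by (rule inj_on_the_inv_into[OF g], rule the_inv_into_onto[OF g])
  obtain s where "is_sum E (g ` J) (f \<circ> h) s"
    using assms(1) orthogonal_system_comp[OF h(1), of E f] assms(3)
    unfolding sigma_orthocomplete_def h(2) by blast
  then have "is_sum E J f s"
    using finite_sums_reindex[OF h(1), of E f] assms(3) unfolding is_sum_def h(2) by simp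
  then show ?thesis by blast
qed


section \<open>Disjointness under the Riesz Decomposition Property\<close>

locale rdp_effect_algebra = effect_algebra +
  assumes rdp: "rdp E"
begin

lemma riesz_refinement:
  assumes "psum x1 x2 z" "psum y1 y2 z"
  obtains c11 c12 c21 c22
  where "psum c11 c12 x1" "psum c21 c22 x2" "psum c11 c21 y1" "psum c12 c22 y2"
proof -
  have carrier: "x1 \<in> carrier E" "x2 \<in> carrier E" "y1 \<in> carrier E" "y2 \<in> carrier E"
    and eq: "x1 \<^bold>+ x2 \<noteq> None" "x1 \<^bold>+ x2 = y1 \<^bold>+ y2"
    using assms by (simp_all add: psum_def)
  obtain p q r s where "p \<in> carrier E" "q \<in> carrier E" "r \<in> carrier E" "s \<in> carrier E"
    "p \<^bold>+ q = Some x1" "r \<^bold>+ s = Some x2" "p \<^bold>+ r = Some y1" "q \<^bold>+ s = Some y2"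
    using rdp[unfolded rdp_def, rule_format, OF carrier eq] by (elim bexE conjE)
  then show ?thesis
    by (intro that[of p q r s]) (simp_all add: psum_def)
qed

lemma riesz_decomposition:
  assumes "psum y1 y2 z" "x \<preceq> z"
  obtains x1 x2 where "psum x1 x2 x" "x1 \<preceq> y1" "x2 \<preceq> y2"
proof -
  obtain x' where x': "psum x x' z"
    using assms(2) le_def by blast
  obtain p q r s where "psum p q x" "psum r s x'" "psum p r y1" "psum q s y2"
    by (rule riesz_refinement[OF x' assms(1)])
  then show ?thesis
    using that[of p q] psum_le(1) by simp
qed

text \<open>
  Refine \<open>x + u = z = y + v\<close>: the common part of \<open>x\<close> and \<open>y\<close> in the refinement is zero by
  disjointness, so all of \<open>y\<close> lies in \<open>u\<close>.
\<close>

lemma disjoint_psum: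
  assumes "disjoint x y" "x \<preceq> z" "y \<preceq> z"
  shows "\<exists>w. psum x y w \<and> w \<preceq> z"
proof -
  obtain u v where uv: "psum x u z" "psum y v z"
    using assms le_def by blast
  then obtain p q r s where c: "psum p q x" "psum r s u" "psum p r y" "psum q s v"
    by (rule riesz_refinement)
  then have "p = \<^bold>0"
    using assms(1) psum_le unfolding disjoint_def by blast
  then have "y = r"
    using c(3) psum_commute[OF psum_zero[OF psum_closed(2)[OF c(3)]]] psum_unique by blast
  then have "y \<preceq> u" 
    using c psum_le by blast
  then show ?thesis
    using uv(1) psum_le_mono by blast
qed

text \<open>
  A common lower bound decomposes along \<open>y1 + y2\<close> into two pieces, each of which is zero.
\<close>

lemma disjoint_sum:
  assumes "disjoint x y1" "disjoint x y2" "psum y1 y2 y"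
  shows "disjoint x y"
  unfolding disjoint_def
proof (intro allI impI)
  fix z assume z: "z \<preceq> x" "z \<preceq> y"
  obtain z1 z2 where d: "psum z1 z2 z" "z1 \<preceq> y1" "z2 \<preceq> y2"
    by (rule riesz_decomposition[OF assms(3) z(2)])
  have "z1 \<preceq> x" "z2 \<preceq> x"
    using d(1) z(1) psum_le le_trans by blast+
  then have "z1 = \<^bold>0" "z2 = \<^bold>0"
    using d assms unfolding disjoint_def by blast+
  then show "z = \<^bold>0"
    using d(1) psum_zero zero_closed psum_unique by blast
qed

text \<open>
  By Riesz decomposition an element below a multiple of \<open>c\<close> is a sum of elements below single
  copies of \<open>c\<close>, each of which is zero or \<open>c\<close>.
\<close>

lemma le_nmult_atom:
  assumes "c \<in> ea_atoms E" "nmult E n c = Some x" "y \<preceq> x"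
  shows "\<exists>k\<le>n. nmult E k c = Some y"
  using assms(2,3)
proof (induction n arbitrary: x y)
  case 0
  then show ?case using le_zero[of y] by simp
next
  case (Suc n)
  obtain u where u: "nmult E n c = Some u" "psum u c x"
    using Suc.prems(1) nmult_Suc_iff atom_closed[OF assms(1)] by blast
  obtain y1 y2 where y: "psum y1 y2 y" "y1 \<preceq> u" "y2 \<preceq> c"
    by (rule riesz_decomposition[OF u(2) Suc.prems(2)])
  obtain k where k: "k \<le> n" "nmult E k c = Some y1"
    using Suc.IH u y by blast
  consider "y2 = \<^bold>0" | "y2 = c"
    using y(3) assms(1) ea_atoms_iff by blast
  then show ?case
  proof cases
    case 1
    then have "y = y1"
      using y(1) psum_zero psum_unique psum_closed by blast
    then show ?thesis using k le_SucI by blast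
  next
    case 2
    then have "nmult E (Suc k) c = Some y"
      using k(2) y(1) nmult_Suc_iff atom_closed[OF assms(1)] by blast
    then show ?thesis using k(1) by blast
  qed
qed


section \<open>Sharp elements\<close>

text \<open>
  A working substitute for centrality that needs only disjointness to be checked: under the Riesz
  Decomposition Property sharp elements are central, and meets with them behave like projections.
\<close>

definition sharp :: "'a \<Rightarrow> bool" where
  "sharp e \<longleftrightarrow> e \<in> carrier E \<and> disjoint e (osupp E e)"

lemma sharp_osupp: "sharp e \<Longrightarrow> sharp (osupp E e)"
  by (simp add: sharp_def osupp_closed osupp_osupp disjoint_commute)

lemma sharp_split:
  assumes "sharp e" "x \<in> carrier E"
  obtains q r where "psum q r x" "q \<preceq> e" "r \<preceq> osupp E e"
proof -
  have "psum e (osupp E e) \<^bold>1"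
    using assms(1) osupp_psum unfolding sharp_def by blast
  then show ?thesis
    using riesz_decomposition[OF _ le_one[OF assms(2)]] that by blast
qed

text \<open>
  Sharp elements are principal: the part of \<open>x + y\<close> below the orthosupplement of \<open>e\<close> is disjoint
  from \<open>x\<close> and from \<open>y\<close>, hence from \<open>x + y\<close> itself.
\<close>

lemma sharp_psum_le:
  assumes "sharp e" "psum x y z" "x \<preceq> e" "y \<preceq> e"
  shows "z \<preceq> e"
proof -
  obtain q r where d: "psum q r z" "q \<preceq> e" "r \<preceq> osupp E e"
    by (rule sharp_split[OF assms(1) psum_closed(3)[OF assms(2)]])
  have "disjoint r x" "disjoint r y"
    using assms d(3) disjoint_mono disjoint_commute unfolding sharp_def by blast+
  then have "disjoint r z"
    using assms(2) disjoint_sum by blast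
  then have "r = \<^bold>0"
    using d(1) psum_le psum_closed le_refl unfolding disjoint_def by blast
  then show ?thesis
    using d psum_zero psum_unique psum_closed by blast
qed

lemma sharp_imp_central:
  assumes "sharp e" shows "e \<in> central_elements E"
proof -
  have principal: "principal E e'" if e': "sharp e'" for e'
    unfolding principal_def
  proof (intro conjI ballI allI impI; (elim conjE)?)
    show "e' \<in> carrier E" using e' by (simp add: sharp_def)
    fix x y z
    assume xy: "x \<in> carrier E" "y \<in> carrier E" "ea_le E x e'" "ea_le E y e'" "x \<^bold>+ y = Some z"
    then have z: "psum x y z"
      by (simp add: psum_def)
    have "z \<preceq> e'"
      using sharp_psum_le[OF e' z] xy by (simp add: ea_le_iff)
    then show "ea_le E z e'"
      using ea_le_iff[OF psum_closed(3)[OF z]] by simp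
  qed
  have "\<exists>q\<in>carrier E. \<exists>r\<in>carrier E. ea_le E q e \<and> ea_le E r (osupp E e) \<and> q \<^bold>+ r = Some p"
    if p: "p \<in> carrier E" for p
  proof -
    obtain q r where qr: "psum q r p" "q \<preceq> e" "r \<preceq> osupp E e"
      by (rule sharp_split[OF assms p])
    then show ?thesis
      using psum_closed(1,2)[OF qr(1)]
      by (intro bexI[of _ q] bexI[of _ r]) (simp_all add: ea_le_iff psum_def)
  qed
  then show ?thesis
    using principal[OF assms] principal[OF sharp_osupp[OF assms]] assms
    by (simp add: central_elements_def sharp_def)
qed

text \<open>
  A lower bound of \<open>x\<close> and \<open>e\<close> decomposes along \<open>x = q + r\<close>; its piece below \<open>r\<close> lies below both \<open>e\<close>
  and its orthosupplement, so it vanishes.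
\<close>

lemma is_glb_sharp_part:
  assumes "sharp e" "psum q r x" "q \<preceq> e" "r \<preceq> osupp E e"
  shows "is_glb (ea_poset E) q {x, e}"
proof -
  have "z \<preceq> q" if z: "z \<preceq> x" "z \<preceq> e" for z
  proof -
    obtain z1 z2 where d: "psum z1 z2 z" "z1 \<preceq> q" "z2 \<preceq> r"
      by (rule riesz_decomposition[OF assms(2) z(1)])
    have "z2 \<preceq> e" "z2 \<preceq> osupp E e"
      using d z(2) assms(4) psum_le le_trans by blast+
    then have "z2 = \<^bold>0"
      using assms(1) unfolding sharp_def disjoint_def by blast
    then show "z \<preceq> q"
      using d psum_zero psum_unique psum_closed by blast
  qed
  then show ?thesis
    using psum_closed[OF assms(2)] psum_le(1)[OF assms(2)] le_closed(2)[OF assms(3)] assms(3)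
    by (simp add: is_glb_iff)
qed

lemma sharp_part_eq_meet:
  assumes "sharp e" "psum q r x" "q \<preceq> e" "r \<preceq> osupp E e"
  shows "x \<sqinter>\<^bsub>ea_poset E\<^esub> e = q"
  using is_glb_sharp_part[OF assms] by (rule meet_eqI)

lemma is_glb_meet_sharp:
  assumes "sharp e" "x \<in> carrier E"
  shows "is_glb (ea_poset E) (x \<sqinter>\<^bsub>ea_poset E\<^esub> e) {x, e}"
proof -
  obtain q r where "psum q r x" "q \<preceq> e" "r \<preceq> osupp E e"
    by (rule sharp_split[OF assms])
  then show ?thesis
    using is_glb_sharp_part[OF assms(1)] sharp_part_eq_meet[OF assms(1)] by simp
qed

lemma le_meet_sharp_iff:
  assumes "sharp e" "x \<in> carrier E"
  shows "z \<preceq> x \<sqinter>\<^bsub>ea_poset E\<^esub> e \<longleftrightarrow> z \<preceq> x \<and> z \<preceq> e"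
proof -
  have "{x, e} \<subseteq> carrier E"
    using assms by (simp add: sharp_def)
  then have "x \<sqinter>\<^bsub>ea_poset E\<^esub> e \<preceq> x" "x \<sqinter>\<^bsub>ea_poset E\<^esub> e \<preceq> e"
    and "z \<preceq> x \<Longrightarrow> z \<preceq> e \<Longrightarrow> z \<preceq> x \<sqinter>\<^bsub>ea_poset E\<^esub> e"
    using is_glb_meet_sharp[OF assms] le_closed(1)[of z x] by (simp_all add: is_glb_iff)
  then show ?thesis
    using le_trans by blast
qed

lemma meet_sharp_closed:
  assumes "sharp e" "x \<in> carrier E"
  shows "x \<sqinter>\<^bsub>ea_poset E\<^esub> e \<in> carrier E"
  using is_glb_meet_sharp[OF assms] assms is_glb_iff[of "{x, e}"] by (simp add: sharp_def)

text \<open>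
  Add the splittings of \<open>x\<close> and \<open>y\<close> componentwise. Since \<open>e\<close> and its orthosupplement are principal,
  the result is again a splitting, and splittings are unique.
\<close>

lemma meet_sharp_psum:
  assumes "sharp e" "psum x y z"
  shows "psum (x \<sqinter>\<^bsub>ea_poset E\<^esub> e) (y \<sqinter>\<^bsub>ea_poset E\<^esub> e) (z \<sqinter>\<^bsub>ea_poset E\<^esub> e)"
proof -
  obtain q1 r1 where 1: "psum q1 r1 x" "q1 \<preceq> e" "r1 \<preceq> osupp E e"
    by (rule sharp_split[OF assms(1) psum_closed(1)[OF assms(2)]])
  obtain q2 r2 where 2: "psum q2 r2 y" "q2 \<preceq> e" "r2 \<preceq> osupp E e"
    by (rule sharp_split[OF assms(1) psum_closed(2)[OF assms(2)]])
  obtain q r where qr: "psum q1 q2 q" "psum r1 r2 r" "psum q r z"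
    using psum_interchange 1 2 assms(2) by blast
  have "q \<preceq> e"
    by (rule sharp_psum_le[OF assms(1) qr(1) 1(2) 2(2)])
  moreover have "r \<preceq> osupp E e"
    by (rule sharp_psum_le[OF sharp_osupp[OF assms(1)] qr(2) 1(3) 2(3)])
  ultimately show ?thesis
    using sharp_part_eq_meet[OF assms(1)] 1 2 qr by simp
qed

end


section \<open>Maximal multiples of atoms\<close>

locale sigma_atomic_effect_algebra = rdp_effect_algebra +
  assumes sigma: "sigma_orthocomplete E"
    and atomic: "atomic E"
begin

lemma obtain_atom:
  assumes "x \<in> carrier E" "x \<noteq> \<^bold>0"
  obtains c where "c \<in> ea_atoms E" "c \<preceq> x"
  using assms atomic atom_closed ea_le_iff that unfolding atomic_def by blast

text \<open>
  If all multiples of \<open>c\<close> were defined, the constant sequence \<open>c, c, \<dots>\<close> would be orthogonal, with a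
  sum \<open>s = c + t\<close>. From \<open>n c + c \<le> s\<close> it follows that \<open>n c \<le> t\<close> for all \<open>n\<close>, hence \<open>s \<le> t\<close>, which is
  impossible for \<open>c \<noteq> 0\<close>.
\<close>

lemma nmult_undefined:
  assumes "c \<in> carrier E" "c \<noteq> \<^bold>0"
  shows "\<exists>n. nmult E n c = None"
proof (rule ccontr)
  assume "\<nexists>n. nmult E n c = None"
  then have defined: "\<exists>x. nmult E n c = Some x" for n
    by auto
  then have "orthogonal_system E (UNIV :: nat set) (\<lambda>_. c)"
    using assms(1) by (auto simp: orthogonal_system_def seq_sum_const)
  then obtain s where s: "is_sum E (UNIV :: nat set) (\<lambda>_. c) s"
    using sigma unfolding sigma_orthocomplete_def by blast
  have sums: "finite_sums E (UNIV :: nat set) (\<lambda>_. c) = {x. \<exists>n. nmult E n c = Some x}"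
  proof (intro equalityI subsetI)
    fix x assume "x \<in> finite_sums E (UNIV :: nat set) (\<lambda>_. c)"
    then show "x \<in> {x. \<exists>n. nmult E n c = Some x}"
      unfolding finite_sums_def seq_sum_const by blast
  next
    fix x assume "x \<in> {x. \<exists>n. nmult E n c = Some x}"
    then obtain n where "nmult E n c = Some x"
      by blast
    then show "x \<in> finite_sums E (UNIV :: nat set) (\<lambda>_. c)"
      unfolding finite_sums_def seq_sum_const
      by (intro CollectI exI[of _ "[0..<n]"]) simp
  qed
  have "{x. \<exists>n. nmult E n c = Some x} \<subseteq> carrier E"
    using assms(1) nmult_closed by blast
  then have lub: "s \<in> carrier E \<and> (\<forall>x\<in>{x. \<exists>n. nmult E n c = Some x}. x \<preceq> s) \<and>
      (\<forall>u. (\<forall>x\<in>{x. \<exists>n. nmult E n c = Some x}. x \<preceq> u) \<longrightarrow> u \<in> carrier E \<longrightarrow> s \<preceq> u)"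
    using s unfolding is_sum_def sums by (simp add: is_lub_iff)
  have ub: "x \<preceq> s" if "nmult E n c = Some x" for x n
    using lub that by blast
  have "nmult E 1 c = Some c"
    using psum_commute[OF psum_zero[OF assms(1)]] by (simp add: psum_def)
  then obtain t where t: "psum c t s"
    using ub le_def by blast
  have "x \<preceq> t" if x: "nmult E n c = Some x" for n x
  proof -
    obtain y where y: "nmult E (Suc n) c = Some y"
      using defined by blast
    then have "psum x c y"
      using nmult_Suc_iff[OF assms(1), of n y] x by auto
    then show "x \<preceq> t"
      using psum_le_cancel[OF psum_commute t ub[OF y]] by blast
  qed
  then have "s \<preceq> t"
    using lub psum_closed(2)[OF t] by blast
  then show False
    using psum_le_imp_zero[OF psum_commute[OF t]] assms(2) by blast
qed

lemma isotropic_index_maximal: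
  assumes "c \<in> ea_atoms E"
  obtains n where "isotropic_index E c = enat n"
    and "nmult E n c = Some (isotropic_mult E c)" and "nmult E (Suc n) c = None"
proof -
  have c: "c \<in> carrier E" "c \<noteq> \<^bold>0"
    using assms ea_atoms_iff by auto
  define N where "N = (LEAST n. nmult E n c = None)"
  have N: "nmult E N c = None"
    unfolding N_def using nmult_undefined[OF c] by (rule LeastI_ex)
  then obtain n where n: "N = Suc n"
    by (cases N) auto
  have "nmult E k c \<noteq> None \<longleftrightarrow> k < N" for k
  proof
    assume "nmult E k c \<noteq> None"
    then obtain x where x: "nmult E k c = Some x"
      by auto
    show "k < N"
      by (rule ccontr) (use nmult_mono[OF c(1) x, of N] N in auto)
  next
    assume "k < N"
    then show "nmult E k c \<noteq> None"
      unfolding N_def by (rule not_less_Least)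
  qed
  then have "{k. nmult E k c \<noteq> None} = {..n}"
    by (auto simp: n)
  moreover have "Sup (enat ` {..n}) = enat n"
    by (rule antisym) (auto intro: Sup_least Sup_upper)
  ultimately have "isotropic_index E c = enat n" "nmult E n c \<noteq> None"
    by (auto simp: isotropic_index_def)
  then show ?thesis
    using that N n by (auto simp: isotropic_mult_def)
qed

lemma isotropic_mult_closed:
  assumes "c \<in> ea_atoms E" shows "isotropic_mult E c \<in> carrier E"
proof -
  obtain n where "nmult E n c = Some (isotropic_mult E c)"
    using isotropic_index_maximal[OF assms] by blast
  then show ?thesis
    by (rule nmult_closed[OF atom_closed[OF assms]])
qed

text \<open>
  Maximality of the isotropic index; sharpness rests on it.
\<close>

lemma isotropic_mult_not_extendable:
  assumes "c \<in> ea_atoms E" shows "\<not> psum (isotropic_mult E c) c z"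
proof -
  obtain n where "nmult E n c = Some (isotropic_mult E c)" "nmult E (Suc n) c = None"
    using isotropic_index_maximal[OF assms] by blast
  then show ?thesis
    using nmult_Suc_iff[OF atom_closed[OF assms], of n z] by auto
qed

lemma le_isotropic_mult:
  assumes "c \<in> ea_atoms E" "x \<preceq> isotropic_mult E c"
  obtains k where "nmult E k c = Some x"
proof -
  obtain n where "nmult E n c = Some (isotropic_mult E c)"
    using isotropic_index_maximal[OF assms(1)] by blast
  then show ?thesis
    using le_nmult_atom[OF assms(1) _ assms(2)] that by blast
qed

lemma atom_le_multiple:
  assumes "c \<in> carrier E" "nmult E k c = Some x" "x \<noteq> \<^bold>0"
  shows "c \<preceq> x"
proof (cases k)
  case 0
  then show ?thesis using assms by simp
next
  case (Suc n)
  then show ?thesis using assms(2) nmult_Suc_iff[OF assms(1)] psum_le(2) by blast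
qed

lemma atom_le_isotropic_mult_part:
  assumes "c \<in> ea_atoms E" "x \<preceq> isotropic_mult E c" "x \<noteq> \<^bold>0"
  shows "c \<preceq> x"
proof -
  obtain k where "nmult E k c = Some x"
    by (rule le_isotropic_mult[OF assms(1,2)])
  then show ?thesis
    by (rule atom_le_multiple[OF atom_closed[OF assms(1)] _ assms(3)])
qed

lemma atom_below_isotropic_mult:
  assumes "c \<in> ea_atoms E" "d \<in> ea_atoms E" "d \<preceq> isotropic_mult E c"
  shows "d = c"
proof -
  have "c \<noteq> \<^bold>0" "d \<noteq> \<^bold>0" and "c \<preceq> d \<Longrightarrow> c = \<^bold>0 \<or> c = d"
    using assms(1,2) unfolding ea_atoms_iff by blast+
  then show ?thesis
    using atom_le_isotropic_mult_part[OF assms(1,3)] by blast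
qed

lemma atom_le_isotropic_mult:
  assumes "c \<in> ea_atoms E" shows "c \<preceq> isotropic_mult E c"
proof -
  have "isotropic_mult E c \<noteq> \<^bold>0"
    using isotropic_mult_not_extendable[OF assms] psum_commute[OF psum_zero[OF atom_closed[OF assms]]]
    by auto
  then show ?thesis
    by (rule atom_le_isotropic_mult_part[OF assms le_refl[OF isotropic_mult_closed[OF assms]]])
qed

text \<open>
  A nonzero common lower bound of \<open>m\<close> and \<open>m'\<close>, where \<open>m\<close> is the largest multiple of \<open>c\<close>, would
  contain \<open>c\<close>; then \<open>c \<le> m'\<close>, so \<open>m + c\<close> would be defined.
\<close>

lemma isotropic_mult_sharp:
  assumes "c \<in> ea_atoms E"
  shows "sharp (isotropic_mult E c)"
  unfolding sharp_def disjoint_def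
proof (intro conjI allI impI isotropic_mult_closed[OF assms])
  fix z assume z: "z \<preceq> isotropic_mult E c" "z \<preceq> osupp E (isotropic_mult E c)"
  show "z = \<^bold>0"
  proof (rule ccontr)
    assume "z \<noteq> \<^bold>0"
    then have "c \<preceq> osupp E (isotropic_mult E c)"
      using atom_le_isotropic_mult_part assms z le_trans by blast
    then show False
      using le_osupp_iff[OF isotropic_mult_closed[OF assms]] isotropic_mult_not_extendable[OF assms]
      by blast
  qed
qed

lemma isotropic_mult_disjoint:
  assumes "c \<in> ea_atoms E" "d \<in> ea_atoms E" "c \<noteq> d"
  shows "disjoint (isotropic_mult E c) (isotropic_mult E d)"
  unfolding disjoint_def
proof (intro allI impI, rule ccontr)
  fix z assume z: "z \<preceq> isotropic_mult E c" "z \<preceq> isotropic_mult E d" "z \<noteq> \<^bold>0"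
  obtain b where b: "b \<in> ea_atoms E" "b \<preceq> z"
    using obtain_atom[OF le_closed(1)[OF z(1)] z(3)] by blast
  have "b = c" "b = d"
    using atom_below_isotropic_mult[OF _ b(1)] le_trans[OF b(2)] z(1,2) assms(1,2) by blast+
  then show False
    using assms(3) by simp
qed

text \<open>
  A principal element that contains \<open>c\<close> contains every existing multiple of \<open>c\<close>, by induction.
\<close>

lemma isotropic_mult_least_central:
  assumes "c \<in> ea_atoms E" "e \<in> central_elements E" "c \<preceq> e"
  shows "isotropic_mult E c \<preceq> e"
proof -
  have c: "c \<in> carrier E" using assms(1) by (rule atom_closed)
  have e: "e \<in> carrier E" "principal E e"
    using assms(2) by (auto simp: central_elements_def)
  have "x \<preceq> e" if "nmult E n c = Some x" for n x
    using that
  proof (induction n arbitrary: x)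
    case 0
    then show ?case using e zero_le by auto
  next
    case (Suc n)
    then obtain y where y: "y \<preceq> e" "psum y c x"
      using nmult_Suc_iff[OF c] by blast
    then show ?case
      using e(2) assms(3) psum_closed[OF y(2)] ea_le_iff y unfolding principal_def psum_def
      by blast
  qed
  then show ?thesis
    using isotropic_index_maximal[OF assms(1)] by blast
qed

lemma isotropic_mult_atom_of_center:
  assumes c: "c \<in> ea_atoms E"
  shows "isotropic_mult E c \<in> atoms_of (center_poset E)"
proof -
  let ?m = "isotropic_mult E c"
  have sub: "central_elements E \<subseteq> carrier E"
    by (auto simp: central_elements_def)
  have "sharp \<^bold>0"
    unfolding sharp_def disjoint_def using zero_closed le_zero by blast
  then have zero: "\<^bold>0 \<in> central_elements E"
    by (rule sharp_imp_central)
  have bot: "\<bottom>\<^bsub>center_poset E\<^esub> = \<^bold>0"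
    by (rule bottom_eq_zero)
      (use sub zero in \<open>auto simp: least_def center_poset_def ea_le_iff[OF zero_closed] zero_le\<close>)
  have m: "?m \<in> central_elements E"
    using isotropic_mult_sharp[OF c] by (rule sharp_imp_central)
  have "c \<preceq> ?m"
    using c by (rule atom_le_isotropic_mult)
  then have nz: "?m \<noteq> \<^bold>0"
    using le_zero[of c] c unfolding ea_atoms_iff by auto
  have "e = \<^bold>0 \<or> e = ?m" if "e \<in> central_elements E" "e \<preceq> ?m" for e
    using atom_le_isotropic_mult_part[OF c that(2)] isotropic_mult_least_central[OF c that(1)]
      le_antisym that(2) by blast
  moreover have "ea_le E x y \<longleftrightarrow> x \<preceq> y" if "x \<in> central_elements E" for x y
    using sub that ea_le_iff by blast
  ultimately have "{x \<in> central_elements E. ea_le E \<^bold>0 x \<and> ea_le E x ?m} = {\<^bold>0, ?m}"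
    using sub zero m zero_le le_refl by blast
  then show ?thesis
    unfolding atoms_of_def bot using m nz by (simp add: center_poset_def)
qed

text \<open>
  The interval below the largest multiple of \<open>c\<close> is the finite chain of the multiples of \<open>c\<close>.
\<close>

lemma isotropic_part_has_greatest:
  assumes "c \<in> ea_atoms E" "T \<noteq> {}" "\<And>t. t \<in> T \<Longrightarrow> t \<preceq> isotropic_mult E c"
  shows "\<exists>g\<in>T. \<forall>t\<in>T. t \<preceq> g"
proof -
  have c: "c \<in> carrier E" using assms(1) by (rule atom_closed)
  define K where "K = {k. \<exists>t\<in>T. nmult E k c = Some t}"
  obtain N where N: "nmult E N c = None"
    using nmult_undefined assms(1) ea_atoms_iff by blast
  have "K \<subseteq> {..<N}"
  proof
    fix k assume "k \<in> K"
    then obtain t where t: "nmult E k c = Some t"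
      unfolding K_def by blast
    have "k < N"
      by (rule ccontr) (use nmult_mono[OF c t, of N] N in auto)
    then show "k \<in> {..<N}" by simp
  qed
  then have "finite K"
    using finite_subset by blast
  have ex: "\<exists>k\<in>K. nmult E k c = Some t" if "t \<in> T" for t
    using le_isotropic_mult[OF assms(1) assms(3)[OF that]] that unfolding K_def by blast
  then have "K \<noteq> {}" using assms(2) by blast
  then have "Max K \<in> K"
    using \<open>finite K\<close> by simp
  then obtain g where g: "g \<in> T" "nmult E (Max K) c = Some g"
    unfolding K_def by blast
  have "t \<preceq> g" if t: "t \<in> T" for t
  proof -
    obtain k where k: "k \<in> K" "nmult E k c = Some t"
      using ex[OF t] by blast
    then show ?thesis
      using nmult_mono[OF c g(2) Max_ge[OF \<open>finite K\<close> k(1)]] by auto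
  qed
  then show ?thesis using g(1) by blast
qed

end


section \<open>Coordinates along the atoms\<close>

locale countably_atomic_effect_algebra = sigma_atomic_effect_algebra E
  for E :: "('a, 'b) effect_alg_scheme" (structure) +
  fixes I :: "'i set" and a :: "'i \<Rightarrow> 'a"
  assumes atoms: "bij_betw a I (ea_atoms E)"
    and countable_atoms: "countable (ea_atoms E)"
begin

abbreviation block :: "'i \<Rightarrow> 'a" where
  "block i \<equiv> isotropic_mult E (a i)"

abbreviation coord :: "'i \<Rightarrow> 'a \<Rightarrow> 'a" where
  "coord i x \<equiv> x \<sqinter>\<^bsub>ea_poset E\<^esub> block i"

lemma atom_index: "i \<in> I \<Longrightarrow> a i \<in> ea_atoms E"
  using atoms bij_betwE by blast

lemma block_sharp: "i \<in> I \<Longrightarrow> sharp (block i)"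
  using atom_index isotropic_mult_sharp by blast

lemma atom_index_inj: "i \<in> I \<Longrightarrow> j \<in> I \<Longrightarrow> i \<noteq> j \<Longrightarrow> a i \<noteq> a j"
  using bij_betw_imp_inj_on[OF atoms] by (auto dest: inj_onD)

lemma block_disjoint: "i \<in> I \<Longrightarrow> j \<in> I \<Longrightarrow> i \<noteq> j \<Longrightarrow> disjoint (block i) (block j)"
  by (intro isotropic_mult_disjoint atom_index atom_index_inj)

lemma le_coord_iff: "i \<in> I \<Longrightarrow> x \<in> carrier E \<Longrightarrow> z \<preceq> coord i x \<longleftrightarrow> z \<preceq> x \<and> z \<preceq> block i"
  using block_sharp le_meet_sharp_iff by blast

lemma coord_closed: "i \<in> I \<Longrightarrow> x \<in> carrier E \<Longrightarrow> coord i x \<in> carrier E"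
  using block_sharp meet_sharp_closed by blast

lemma coord_le: 
  assumes "i \<in> I" "x \<in> carrier E" shows "coord i x \<preceq> x" "coord i x \<preceq> block i"
  using le_coord_iff[OF assms] coord_closed[OF assms] le_refl by blast+

lemma coord_one: "coord i \<^bold>1 = block i" if i: "i \<in> I"
proof (rule le_antisym)
  show "coord i \<^bold>1 \<preceq> block i"
    by (rule coord_le(2)[OF i one_closed])
  have "block i \<in> carrier E"
    by (rule isotropic_mult_closed[OF atom_index[OF i]])
  then show "block i \<preceq> coord i \<^bold>1"
    by (simp add: le_coord_iff[OF i one_closed] le_one le_refl)
qed

lemma coord_psum: "i \<in> I \<Longrightarrow> psum x y z \<Longrightarrow> psum (coord i x) (coord i y) (coord i z)"
  using block_sharp meet_sharp_psum by blast

lemma obtain_atom_index: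
  assumes "x \<in> carrier E" "x \<noteq> \<^bold>0"
  obtains i where "i \<in> I" "a i \<preceq> x"
proof -
  obtain c where c: "c \<in> ea_atoms E" "c \<preceq> x"
    by (rule obtain_atom[OF assms])
  then obtain i where "i \<in> I" "c = a i"
    using bij_betw_imp_surj_on[OF atoms] by blast
  then show ?thesis
    using that[of i] c(2) by simp
qed

text \<open>
  The finite sum exists and is the join of its members. Disjointness from the blocks that have not
  been used yet is the invariant that permits the next member to be added.
\<close>

lemma seq_sum_blocks:
  assumes "\<And>i. i \<in> I \<Longrightarrow> f i \<preceq> block i" "distinct is" "set is \<subseteq> I"
  shows "\<exists>s. seq_sum E (map f is) = Some s \<and> s \<in> carrier E \<and>
    (\<forall>z\<in>carrier E. s \<preceq> z \<longleftrightarrow> (\<forall>i\<in>set is. f i \<preceq> z)) \<and>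
    (\<forall>j\<in>I - set is. disjoint (block j) s)"
  using assms(2,3)
proof (induction "is" rule: rev_induct)
  case Nil
  have "disjoint x \<^bold>0" for x
    unfolding disjoint_def using le_zero by blast
  then show ?case
    using zero_closed zero_le by (simp add: seq_sum_def)
next
  case (snoc i "is")
  then obtain s where s: "seq_sum E (map f is) = Some s" "s \<in> carrier E"
    and le: "\<And>z. z \<in> carrier E \<Longrightarrow> s \<preceq> z \<longleftrightarrow> (\<forall>i\<in>set is. f i \<preceq> z)"
    and disj: "\<And>j. j \<in> I - set is \<Longrightarrow> disjoint (block j) s"
    by auto
  have i: "i \<in> I" "i \<notin> set is" 
    using snoc.prems by auto
  have fi: "f i \<preceq> block i" "f i \<in> carrier E"
    using assms(1) i le_closed by blast+
  have d: "disjoint s (f i)"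
    using disjoint_mono[OF disj fi(1) le_refl[OF s(2)]] i disjoint_commute by blast
  then obtain w where w: "psum s (f i) w"
    using disjoint_psum[OF _ le_one[OF s(2)] le_one[OF fi(2)]] by blast
  have "w \<preceq> z \<longleftrightarrow> s \<preceq> z \<and> f i \<preceq> z" for z
  proof
    assume "w \<preceq> z"
    then show "s \<preceq> z \<and> f i \<preceq> z"
      using psum_le[OF w] le_trans by blast
  next
    assume "s \<preceq> z \<and> f i \<preceq> z"
    then show "w \<preceq> z"
      using disjoint_psum[OF d] psum_unique[OF w] by blast
  qed
  then have "(\<forall>z\<in>carrier E. w \<preceq> z \<longleftrightarrow> (\<forall>j\<in>set (is @ [i]). f j \<preceq> z))"
    using le by auto
  moreover have "disjoint (block j) w" if "j \<in> I - set (is @ [i])" for j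
  proof (rule disjoint_sum[OF _ _ w])
    show "disjoint (block j) s" using disj that by simp
    show "disjoint (block j) (f i)"
    proof (rule disjoint_mono)
      show "disjoint (block j) (block i)"
        using that i(1) by (intro block_disjoint) auto
      show "block j \<preceq> block j"
        using that by (intro le_refl isotropic_mult_closed atom_index) auto
      show "f i \<preceq> block i" by (rule fi(1))
    qed
  qed
  moreover have "seq_sum E (map f (is @ [i])) = Some w"
    using s(1) w by (simp add: seq_sum_snoc psum_def)
  ultimately show ?case
    using psum_closed(3)[OF w] by blast
qed

lemma blocks_orthogonal:
  assumes "\<And>i. i \<in> I \<Longrightarrow> f i \<preceq> block i"
  shows "orthogonal_system E I f"
  unfolding orthogonal_system_def
proof (intro conjI allI impI)
  show "f ` I \<subseteq> carrier E"
    using assms le_closed(1) by blast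
  show "seq_sum E (map f js) \<noteq> None" if "distinct js \<and> set js \<subseteq> I" for js
    using seq_sum_blocks[of f js, OF assms] that by auto
qed

text \<open>
  Since finite sums are joins, the sum of the whole family is its least upper bound; finite sums can
  be forgotten from here on.
\<close>

lemma is_sum_blocks_iff:
  assumes "\<And>i. i \<in> I \<Longrightarrow> f i \<preceq> block i"
  shows "is_sum E I f s \<longleftrightarrow> s \<in> carrier E \<and> (\<forall>z\<in>carrier E. s \<preceq> z \<longleftrightarrow> (\<forall>i\<in>I. f i \<preceq> z))"
proof -
  have sums: "\<exists>js. set js \<subseteq> I \<and> x \<in> carrier E \<and>
      (\<forall>z\<in>carrier E. x \<preceq> z \<longleftrightarrow> (\<forall>j\<in>set js. f j \<preceq> z))"
    if "x \<in> finite_sums E I f" for x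
  proof -
    obtain js where "distinct js" "set js \<subseteq> I" "seq_sum E (map f js) = Some x"
      using \<open>x \<in> finite_sums E I f\<close> unfolding finite_sums_def by blast
    then show ?thesis
      using seq_sum_blocks[of f js, OF assms] by auto
  qed
  then have sub: "finite_sums E I f \<subseteq> carrier E"
    by blast
  have single: "f i \<in> finite_sums E I f" if i: "i \<in> I" for i
  proof -
    have "psum \<^bold>0 (f i) (f i)"
      by (rule psum_commute[OF psum_zero[OF le_closed(1)[OF assms[OF i]]]])
    then have "seq_sum E (map f [i]) = Some (f i)"
      by (simp add: seq_sum_def psum_def)
    then show ?thesis
      unfolding finite_sums_def using i by (intro CollectI exI[of _ "[i]"]) simp
  qed
  have ub: "(\<forall>x\<in>finite_sums E I f. x \<preceq> z) \<longleftrightarrow> (\<forall>i\<in>I. f i \<preceq> z)" if "z \<in> carrier E" for z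
    using single sums that by blast
  have "is_sum E I f s \<longleftrightarrow> s \<in> carrier E \<and> (\<forall>i\<in>I. f i \<preceq> s) \<and>
      (\<forall>z\<in>carrier E. (\<forall>i\<in>I. f i \<preceq> z) \<longrightarrow> s \<preceq> z)"
    unfolding is_sum_def is_lub_iff[OF sub] using blocks_orthogonal[of f, OF assms] ub by auto
  also have "\<dots> \<longleftrightarrow> s \<in> carrier E \<and> (\<forall>z\<in>carrier E. s \<preceq> z \<longleftrightarrow> (\<forall>i\<in>I. f i \<preceq> z))"
    using le_refl[of s] le_trans[of _ s] by blast
  finally show ?thesis .
qed

lemma blocks_sum_exists:
  assumes "\<And>i. i \<in> I \<Longrightarrow> f i \<preceq> block i"
  obtains s where "is_sum E I f s"
proof -
  have "countable I"
    using countable_atoms bij_betw_imp_surj_on[OF atoms]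
    by (intro countable_image_inj_on[OF _ bij_betw_imp_inj_on[OF atoms]]) simp
  then obtain s where "is_sum E I f s"
    using sigma_orthocomplete_countable[OF sigma _ blocks_orthogonal[of f, OF assms]] by blast
  then show ?thesis by (rule that)
qed

text \<open>
  The sum \<open>s\<close> of the coordinates is below \<open>y\<close>. If \<open>y = s + t\<close> with an atom \<open>a i \<le> t\<close>, then
  \<open>coord i y + a i\<close> is below \<open>y\<close> and, the block being principal, below \<open>block i\<close>. So it is below
  \<open>coord i y\<close>, which is absurd.
\<close>

lemma is_sum_coords:
  assumes "y \<in> carrier E"
  shows "is_sum E I (\<lambda>i. coord i y) y"
proof -
  note le_block = coord_le(2)[OF _ assms]
  obtain s where s: "is_sum E I (\<lambda>i. coord i y) s"
    by (rule blocks_sum_exists[of "\<lambda>i. coord i y", OF le_block])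
  then have sc: "s \<in> carrier E" 
    and le: "\<And>z. z \<in> carrier E \<Longrightarrow> s \<preceq> z \<longleftrightarrow> (\<forall>i\<in>I. coord i y \<preceq> z)"
    using is_sum_blocks_iff[of "\<lambda>i. coord i y", OF le_block] by auto
  have "s \<preceq> y"
    using le assms coord_le by blast
  then obtain t where t: "psum s t y"
    using le_def by blast
  have "t = \<^bold>0"
  proof (rule ccontr)
    assume "t \<noteq> \<^bold>0"
    then obtain i where i: "i \<in> I" "a i \<preceq> t"
      using obtain_atom_index[OF psum_closed(2)[OF t]] by blast
    have "coord i y \<preceq> s"
      using le[OF sc] le_refl[OF sc] i(1) by blast
    obtain w where w: "psum s (a i) w" "w \<preceq> y"
      using psum_le_mono[OF t i(2)] by blast
    obtain v where v: "psum (coord i y) (a i) v" "v \<preceq> w"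
      using psum_le_mono[OF psum_commute[OF w(1)] \<open>coord i y \<preceq> s\<close>] psum_commute by blast
    have "a i \<preceq> block i"
      using atom_le_isotropic_mult atom_index i(1) by blast
    then have "v \<preceq> block i"
      using sharp_psum_le[OF block_sharp[OF i(1)] v(1) coord_le(2)[OF i(1) assms]] by blast
    then have "v \<preceq> coord i y"
      using le_coord_iff[OF i(1) assms] le_trans[OF v(2) w(2)] by blast
    then show False
      using psum_le_imp_zero[OF v(1)] atom_index[OF i(1)] ea_atoms_iff by blast
  qed
  then show ?thesis
    using s psum_unique[OF psum_zero[OF sc], of y] t by simp
qed

lemma le_iff_coords:
  assumes "x \<in> carrier E" "y \<in> carrier E"
  shows "x \<preceq> y \<longleftrightarrow> (\<forall>i\<in>I. coord i x \<preceq> coord i y)"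
proof -
  have "x \<preceq> y \<longleftrightarrow> (\<forall>i\<in>I. coord i x \<preceq> y)"
    using is_sum_coords[OF assms(1)] assms(2)
    by (simp add: is_sum_blocks_iff[OF coord_le(2)[OF _ assms(1)]])
  then show ?thesis
    using le_coord_iff[OF _ assms(2)] coord_le(2)[OF _ assms(1)] by blast
qed

text \<open>
  If \<open>coord i s\<close> exceeds \<open>f i\<close>, then \<open>s = w + a i\<close> with \<open>f i \<le> w\<close>. The other members are below \<open>w\<close>
  too: their part below \<open>a i\<close> vanishes because they lie in other blocks. So \<open>w\<close> is an upper bound
  of the family that is strictly below its supremum \<open>s\<close>.
\<close>

lemma coord_sum:
  assumes f: "\<And>i. i \<in> I \<Longrightarrow> f i \<preceq> block i" and s: "is_sum E I f s" and i: "i \<in> I"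
  shows "coord i s = f i"
proof -
  have sc: "s \<in> carrier E" 
    and le: "\<And>z. z \<in> carrier E \<Longrightarrow> s \<preceq> z \<longleftrightarrow> (\<forall>i\<in>I. f i \<preceq> z)"
    using is_sum_blocks_iff[of f, OF f] s by auto
  have upper: "f j \<preceq> s" if "j \<in> I" for j
    using le[OF sc] le_refl[OF sc] that by blast
  have "f i \<preceq> coord i s"
    using le_coord_iff[OF i sc] f upper i by blast
  then obtain t where t: "psum (f i) t (coord i s)"
    using le_def by blast
  have "t = \<^bold>0"
  proof (rule ccontr)
    assume "t \<noteq> \<^bold>0"
    then have "a i \<preceq> t"
      using atom_le_isotropic_mult_part[OF atom_index[OF i]]
        le_trans[OF psum_le(2)[OF t] coord_le(2)[OF i sc]] by blast
    then obtain v where v: "psum (f i) (a i) v" "v \<preceq> coord i s"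
      using psum_le_mono[OF t] by blast
    obtain u where u: "psum v u s"
      using le_trans[OF v(2) coord_le(1)[OF i sc]] le_def by blast
    obtain u' where u': "psum (a i) u u'" "psum (f i) u' s"
      using psum_assoc[OF v(1) u] by blast
    obtain w where w: "psum (f i) u w" "psum w (a i) s"
      using psum_assoc'[OF psum_commute[OF u'(1)] u'(2)] by blast
    have "f j \<preceq> w" if j: "j \<in> I" for j
    proof (cases "j = i")
      case True
      then show ?thesis using psum_le(1)[OF w(1)] by simp
    next
      case False
      obtain x1 x2 where x: "psum x1 x2 (f j)" "x1 \<preceq> w" "x2 \<preceq> a i"
        by (rule riesz_decomposition[OF w(2) upper[OF j]])
      have "x2 \<preceq> block j"
        by (rule le_trans[OF psum_le(2)[OF x(1)] f[OF j]])
      moreover have "a i \<noteq> a j"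
        using False i j atom_index_inj by blast
      moreover have "x2 = \<^bold>0 \<or> x2 = a i"
        using x(3) atom_index[OF i] ea_atoms_iff by blast
      ultimately have "x2 = \<^bold>0"
        using atom_below_isotropic_mult[OF atom_index[OF j] atom_index[OF i]] by blast
      then show ?thesis
        using psum_unique[OF psum_zero[OF psum_closed(1)[OF x(1)]], of "f j"] x(1,2) by simp
    qed
    then have "s \<preceq> w"
      using le[OF psum_closed(3)[OF w(1)]] by blast
    then show False
      using psum_le_imp_zero[OF w(2)] atom_index[OF i] ea_atoms_iff by blast
  qed
  then show ?thesis
    using psum_unique[OF psum_zero[OF psum_closed(1)[OF t]], of "coord i s"] t by simp
qed

lemma coords_prescribed:
  assumes "\<And>i. i \<in> I \<Longrightarrow> f i \<preceq> block i"
  obtains s where "s \<in> carrier E" "\<And>i. i \<in> I \<Longrightarrow> coord i s = f i"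
proof -
  obtain s where s: "is_sum E I f s"
    by (rule blocks_sum_exists[of f, OF assms])
  then have "s \<in> carrier E"
    using is_sum_blocks_iff[of f, OF assms] by blast
  then show ?thesis
    by (rule that) (rule coord_sum[of f, OF assms s])
qed

text \<open>
  The coordinates of \<open>x\<close> and of its orthosupplement add up to the blocks. Cancelling the
  coordinates of \<open>x\<close> shows that \<open>y\<close> is coordinatewise, hence truly, below the orthosupplement.
\<close>

lemma coords_psum:
  assumes "x \<in> carrier E" "y \<in> carrier E" 
    and sums: "\<And>i. i \<in> I \<Longrightarrow> \<exists>w. psum (coord i x) (coord i y) w \<and> w \<preceq> block i"
  shows "\<exists>z. psum x y z"
proof -
  have "coord i y \<preceq> coord i (osupp E x)" if i: "i \<in> I" for i
  proof -
    have "psum (coord i x) (coord i (osupp E x)) (block i)"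
      using coord_psum[OF i osupp_psum[OF assms(1)]] coord_one[OF i] by simp
    then show ?thesis
      using sums[OF i] psum_le_cancel by blast
  qed
  then have "y \<preceq> osupp E x"
    using le_iff_coords[OF assms(2) osupp_closed[OF assms(1)]] by blast
  then show ?thesis
    using le_osupp_iff[OF assms(1)] by blast
qed


section \<open>The product decomposition and the lattice structure\<close>

lemma coords_iso:
  "(\<lambda>x. \<lambda>i\<in>I. coord i x) \<in> ea_iso E (ea_product I (\<lambda>i. ea_interval E (block i)))"
proof -
  let ?F = "\<lambda>i. ea_interval E (block i)"
  let ?\<phi> = "\<lambda>x. \<lambda>i\<in>I. coord i x"
  have carrier_F: "carrier (?F i) = {x. x \<preceq> block i}" for i
  proof -
    have "x \<in> carrier E \<and> ea_le E \<^bold>0 x \<and> ea_le E x (block i) \<longleftrightarrow> x \<preceq> block i" for x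
      using le_closed(1) zero_le[of x] ea_le_iff[of x] ea_le_iff[OF zero_closed] by blast
    then show ?thesis
      by (simp add: ea_interval_def)
  qed
  have padd_F: "x \<^bold>+\<^bsub>?F i\<^esub> y = Some z \<longleftrightarrow> psum x y z \<and> z \<preceq> block i" 
    if "x \<in> carrier E" "y \<in> carrier E" for i x y z
  proof (cases "x \<^bold>+ y")
    case None
    then show ?thesis by (simp add: ea_interval_def psum_def)
  next
    case (Some w)
    then have "ea_le E w (block i) \<longleftrightarrow> w \<preceq> block i"
      using padd_closed[OF that] ea_le_iff by blast
    then show ?thesis
      using that Some by (auto simp: ea_interval_def psum_def)
  qed
  have inj: "inj_on ?\<phi> (carrier E)"
  proof (rule inj_onI)
    fix x y assume xy: "x \<in> carrier E" "y \<in> carrier E" "?\<phi> x = ?\<phi> y"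
    have eq: "coord i x = coord i y" if "i \<in> I" for i
      using fun_cong[OF xy(3), of i] that by simp
    show "x = y"
    proof (rule le_antisym)
      show "x \<preceq> y"
        by (subst le_iff_coords[OF xy(1,2)]) (use eq le_refl coord_closed xy(2) in auto)
      show "y \<preceq> x"
        by (subst le_iff_coords[OF xy(2,1)]) (use eq le_refl coord_closed xy(2) in auto)
    qed
  qed
  have "?\<phi> ` carrier E = (\<Pi>\<^sub>E i\<in>I. {x. x \<preceq> block i})"
  proof (intro equalityI subsetI)
    fix f assume "f \<in> ?\<phi> ` carrier E"
    then show "f \<in> (\<Pi>\<^sub>E i\<in>I. {x. x \<preceq> block i})"
      using coord_le(2) by auto
  next
    fix f assume f: "f \<in> (\<Pi>\<^sub>E i\<in>I. {x. x \<preceq> block i})"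
    then have "f i \<preceq> block i" if "i \<in> I" for i
      using PiE_mem[OF f that] by simp
    then obtain s where s: "s \<in> carrier E" "\<And>i. i \<in> I \<Longrightarrow> coord i s = f i"
      using coords_prescribed[of f] by blast
    have "?\<phi> s = f"
    proof
      fix i show "?\<phi> s i = f i"
        using s(2) PiE_arb[OF f] by simp
    qed
    then show "f \<in> ?\<phi> ` carrier E"
      using s(1) by blast
  qed
  then have bij: "bij_betw ?\<phi> (carrier E) (carrier (ea_product I ?F))"
    using inj by (simp add: bij_betw_def ea_product_def carrier_F)
  have one: "?\<phi> \<^bold>1 = \<^bold>1\<^bsub>ea_product I ?F\<^esub>"
    using coord_one by (auto simp: ea_product_def ea_interval_def)
  have hom: "?\<phi> x \<^bold>+\<^bsub>ea_product I ?F\<^esub> ?\<phi> y = Some (?\<phi> z)" if z: "psum x y z" for x y z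
  proof -
    have "coord i x \<^bold>+\<^bsub>?F i\<^esub> coord i y = Some (coord i z)" if i: "i \<in> I" for i
      using coord_psum[OF i z] coord_le(2)[OF i psum_closed(3)[OF z]]
      by (subst padd_F) (simp_all add: psum_closed[OF coord_psum[OF i z]])
    then show ?thesis
      by (auto simp: ea_product_def fun_eq_iff restrict_def)
  qed
  have "\<exists>z. psum x y z" if xy: "x \<in> carrier E" "y \<in> carrier E"
    and def: "?\<phi> x \<^bold>+\<^bsub>ea_product I ?F\<^esub> ?\<phi> y \<noteq> None" for x y
  proof (rule coords_psum[OF xy])
    fix i assume i: "i \<in> I"
    then have "coord i x \<^bold>+\<^bsub>?F i\<^esub> coord i y \<noteq> None"
      using def by (auto simp: ea_product_def split: if_splits)
    then show "\<exists>w. psum (coord i x) (coord i y) w \<and> w \<preceq> block i"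
      using padd_F[OF coord_closed[OF i xy(1)] coord_closed[OF i xy(2)], of i] by auto
  qed
  then have defined: "x \<^bold>+ y \<noteq> None \<longleftrightarrow> ?\<phi> x \<^bold>+\<^bsub>ea_product I ?F\<^esub> ?\<phi> y \<noteq> None"
    if "x \<in> carrier E" "y \<in> carrier E" for x y
    using hom[of x y] that by (auto simp: psum_def)
  show ?thesis
    unfolding ea_iso_def
  proof (intro CollectI conjI ballI allI impI bij one)
    show "x \<^bold>+ y \<noteq> None \<longleftrightarrow> ?\<phi> x \<^bold>+\<^bsub>ea_product I ?F\<^esub> ?\<phi> y \<noteq> None"
      if "x \<in> carrier E" "y \<in> carrier E" for x y
      using that by (rule defined)
    show "?\<phi> x \<^bold>+\<^bsub>ea_product I ?F\<^esub> ?\<phi> y = Some (?\<phi> z)"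
      if "x \<in> carrier E" "y \<in> carrier E" "x \<^bold>+ y = Some z" for x y z
      using that by (intro hom) (simp add: psum_def)
  qed
qed

text \<open>
  In each coordinate the supremum is a greatest element of a nonempty subset of a finite chain. Zero
  is inserted because \<open>S\<close> may be empty.
\<close>

lemma lub_exists:
  assumes S: "S \<subseteq> carrier E"
  shows "\<exists>s. is_lub (ea_poset E) s S"
proof -
  have below: "t \<preceq> block i" if "i \<in> I" "t \<in> insert \<^bold>0 (coord i ` S)" for i t
    using that S coord_le(2) zero_le[OF isotropic_mult_closed[OF atom_index]] by auto
  have "\<exists>g\<in>insert \<^bold>0 (coord i ` S). \<forall>t\<in>insert \<^bold>0 (coord i ` S). t \<preceq> g" if i: "i \<in> I" for i
    using below[OF i] by (intro isotropic_part_has_greatest[OF atom_index[OF i]]) auto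
  then obtain f where f: "\<And>i. i \<in> I \<Longrightarrow> f i \<in> insert \<^bold>0 (coord i ` S)"
    "\<And>i t. i \<in> I \<Longrightarrow> t \<in> insert \<^bold>0 (coord i ` S) \<Longrightarrow> t \<preceq> f i"
    by metis
  obtain s where s: "s \<in> carrier E" "\<And>i. i \<in> I \<Longrightarrow> coord i s = f i"
    using coords_prescribed[of f] below f(1) by blast
  have "x \<preceq> s" if "x \<in> S" for x
    using f(2) s that S by (subst le_iff_coords) auto
  moreover have "s \<preceq> u" if u: "u \<in> carrier E" "\<And>x. x \<in> S \<Longrightarrow> x \<preceq> u" for u
  proof -
    have "coord i s \<preceq> coord i u" if i: "i \<in> I" for i
    proof -
      have "\<^bold>0 \<preceq> coord i u"
        by (rule zero_le[OF coord_closed[OF i u(1)]])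
      moreover have "coord i x \<preceq> coord i u" if "x \<in> S" for x
        using le_iff_coords[of x u] u that S i by blast
      ultimately show ?thesis
        using f(1)[OF i] s(2)[OF i] by auto
    qed
    then show ?thesis
      using le_iff_coords[OF s(1) u(1)] by blast
  qed
  ultimately show ?thesis
    using is_lub_iff[OF S] s(1) by blast
qed

lemma glb_exists:
  assumes S: "S \<subseteq> carrier E"
  shows "\<exists>s. is_glb (ea_poset E) s S"
proof -
  let ?L = "{u \<in> carrier E. \<forall>x\<in>S. u \<preceq> x}"
  obtain s where "is_lub (ea_poset E) s ?L"
    using lub_exists[of ?L] by blast
  moreover have "?L \<subseteq> carrier E"
    by blast
  ultimately have s: "s \<in> carrier E" "\<forall>u\<in>?L. u \<preceq> s"
    and least: "\<And>v. \<forall>u\<in>?L. u \<preceq> v \<Longrightarrow> v \<in> carrier E \<Longrightarrow> s \<preceq> v"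
    using is_lub_iff[of ?L] by blast+
  have "s \<preceq> x" if "x \<in> S" for x
    using least[of x] S that by blast
  then have "is_glb (ea_poset E) s S"
    using s by (simp add: is_glb_iff[OF S])
  then show ?thesis by blast
qed

text \<open>
  With \<open>c = x \<and> y\<close>, the remainders of \<open>x\<close> and \<open>y\<close> after subtracting \<open>c\<close> are disjoint and lie below the
  orthosupplement of \<open>c\<close>; hence so does their sum, and \<open>c\<close> can be added to it.
\<close>

lemma all_compatible:
  assumes "x \<in> carrier E" "y \<in> carrier E"
  shows "compatible E x y"
proof -
  have sub: "{x, y} \<subseteq> carrier E"
    using assms by simp
  obtain c where "is_glb (ea_poset E) c {x, y}"
    using glb_exists[OF sub] by blast
  then have c: "c \<preceq> x" "c \<preceq> y" and greatest: "\<And>u. u \<preceq> x \<Longrightarrow> u \<preceq> y \<Longrightarrow> u \<preceq> c"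
    using le_closed(1) by (simp_all add: is_glb_iff[OF sub])
  then obtain x1 y1 where xy: "psum c x1 x" "psum c y1 y"
    using le_def by blast
  have "disjoint x1 y1"
    unfolding disjoint_def
  proof (intro allI impI)
    fix z assume "z \<preceq> x1" "z \<preceq> y1"
    then obtain u v where u: "psum c z u" "u \<preceq> x" and v: "psum c z v" "v \<preceq> y"
      using psum_le_mono[OF xy(1)] psum_le_mono[OF xy(2)] by blast
    have "v = u"
      by (rule psum_unique[OF v(1) u(1)])
    then have "u \<preceq> c"
      using greatest u(2) v(2) by simp
    then show "z = \<^bold>0"
      by (rule psum_le_imp_zero[OF u(1)])
  qed
  moreover have "x1 \<preceq> osupp E c" "y1 \<preceq> osupp E c"
    using xy le_osupp_iff[OF le_closed(1)[OF c(1)]] by blast+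
  ultimately obtain w where w: "psum x1 y1 w" "w \<preceq> osupp E c"
    using disjoint_psum by blast
  obtain v where "psum c w v"
    using le_osupp_iff[OF le_closed(1)[OF c(1)]] w(2) by blast
  then have "psum w c v"
    by (rule psum_commute)
  then have "x1 \<^bold>+ c = Some x \<and> y1 \<^bold>+ c = Some y \<and> 
      Option.bind (x1 \<^bold>+ y1) (\<lambda>s. s \<^bold>+ c) \<noteq> None"
    using w(1) psum_commute[OF xy(1)] psum_commute[OF xy(2)] by (simp add: psum_def)
  then show ?thesis
    unfolding compatible_def using psum_closed(1,2)[OF w(1)] le_closed(1)[OF c(1)] by blast
qed

lemma sigma_complete_mv: "sigma_complete_mv_effect_algebra E"
proof -
  interpret partial_order "ea_poset E"
    by (rule partial_order_ea_poset)
  interpret lattice "ea_poset E"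
    by unfold_locales (use lub_exists glb_exists in \<open>simp_all add: ea_poset_def\<close>)
  show ?thesis
    by unfold_locales (rule all_compatible lub_exists glb_exists; assumption)+
qed

end

theorem theorem4p11:
  fixes E :: "'a effect_alg" and I :: "'i set" and a :: "'i \<Rightarrow> 'a"
  assumes "effect_algebra E"
    and "sigma_orthocomplete E"
    and "atomic E"
    and "rdp E"
    and "bij_betw a I (ea_atoms E)"
    and "countable (ea_atoms E)"
  shows "(\<forall>i\<in>I. isotropic_index E (a i) \<noteq> \<infinity>) \<and>
    (\<forall>i\<in>I. isotropic_mult E (a i) \<in> central_elements E) \<and>
    (\<forall>i\<in>I. isotropic_mult E (a i) \<in> atoms_of (center_poset E)) \<and>
    (\<forall>y\<in>carrier E.
       (\<forall>i\<in>I. is_glb (ea_poset E) (y \<sqinter>\<^bsub>ea_poset E\<^esub> isotropic_mult E (a i))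
                 {y, isotropic_mult E (a i)}) \<and>
       is_sum E I (\<lambda>i. y \<sqinter>\<^bsub>ea_poset E\<^esub> isotropic_mult E (a i)) y) \<and>
    ea_isomorphic E (ea_product I (\<lambda>i. ea_interval E (isotropic_mult E (a i)))) \<and>
    sigma_complete_mv_effect_algebra E"
proof -
  interpret effect_algebra E by (rule assms(1))
  interpret countably_atomic_effect_algebra E I a
    by unfold_locales (use assms in auto)
  have "isotropic_index E (a i) \<noteq> \<infinity>" if "i \<in> I" for i
    using isotropic_index_maximal[OF atom_index[OF that]] by (metis enat.distinct(1))
  moreover have "ea_isomorphic E (ea_product I (\<lambda>i. ea_interval E (block i)))"
    using coords_iso unfolding ea_isomorphic_def by blast
  ultimately show ?thesis
    using block_sharp sharp_imp_central isotropic_mult_atom_of_center atom_index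
      is_glb_meet_sharp is_sum_coords sigma_complete_mv by auto
qed

end
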